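(* Let $n\in\mathbb{N}$ and let $q>n$ be a prime power. Let $\mathcal{P}$ be a set of points in $\mathbb{F}_q^2$, and let $\mathcal{Q}$ be a collection of subsets of $\mathbb{F}_q^2$, each of the shape $$\{(x,y)\in\mathbb{F}_q^2: y=a_nx^n+\cdots+a_0\}$$ for some $a_n,\ldots,a_0\in\mathbb{F}_q$. Then $$\left|\#\{(\mathfrak{p},\mathfrak{q})\in\mathcal{P}\times\mathcal{Q}:\mathfrak{p}\in\mathfrak{q}\}-\frac{|\mathcal{P}|\cdot|\mathcal{Q}|}{q}\right|\le q^{n/2}\sqrt{|\mathcal{P}|\cdot|\mathcal{Q}|}.$$ *)

theory Defs
  imports Complex_Main "HOL-Library.Cardinality" "HOL-Number_Theory.Prime_Powers"
begin

end

theory Submission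
  imports Defs "HOL-Library.FuncSet" "HOL-Analysis.Convex"
begin

text \<open>
  Second moment method. For a uniformly random coefficient vector, the events that two points
  with distinct abscissae lie on the graph are independent of probability \<open>1/q\<close>, and for
  distinct points with the same abscissa they are disjoint. Hence the number of points of \<open>P\<close> on
  a random graph has mean \<open>|P|/q\<close> and variance at most \<open>|P|/q\<close>. Since \<open>Q\<close> injects into the set
  of all \<open>q^(n+1)\<close> coefficient vectors, the Cauchy--Schwarz inequality over \<open>Q\<close> gives the bound.
\<close>

definition poly_graph :: "nat \<Rightarrow> (nat \<Rightarrow> 'a::field) \<Rightarrow> ('a \<times> 'a) set" where
  "poly_graph n a = {(x, y). y = (\<Sum>i\<le>n. a i * x ^ i)}"

text \<open>Extensional functions fix the values beyond \<open>n\<close> to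
  \<open>undefined\<close>, so each choice of coefficients has one representative and the set is
  finite.\<close>

definition coeff_vecs :: "nat \<Rightarrow> (nat \<Rightarrow> 'a) set" where
  "coeff_vecs n = {..n} \<rightarrow>\<^sub>E UNIV"

lemma finite_coeff_vecs [simp]: "finite (coeff_vecs n :: (nat \<Rightarrow> 'a::finite) set)"
  by (simp add: coeff_vecs_def finite_PiE)

lemma card_coeff_vecs: "card (coeff_vecs n :: (nat \<Rightarrow> 'a::finite) set) = CARD('a) ^ Suc n"
  by (simp add: coeff_vecs_def card_PiE)

lemma poly_graph_restrict: "poly_graph n (restrict a {..n}) = poly_graph n a"
  by (simp add: poly_graph_def)

text \<open>The coefficients of degree 1 to \<open>n\<close> are free, and the incidence with
  \<open>p\<close> then determines the constant coefficient.\<close>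

lemma card_coeff_vecs_through_point:
  fixes p :: "'a::{field,finite} \<times> 'a"
  shows "card {a \<in> coeff_vecs n. p \<in> poly_graph n a} = CARD('a) ^ n"
proof -
  obtain x y where p: "p = (x, y)" by (cases p)
  let ?h = "\<lambda>c::nat \<Rightarrow> 'a. \<Sum>i\<in>{1..n}. c i * x ^ i"
  have atMost: "{..n} = insert 0 {1..n}" by auto
  have split: "(\<Sum>i\<le>n. c i * x ^ i) = c 0 + ?h c" for c :: "nat \<Rightarrow> 'a"
    unfolding atMost by (subst sum.insert) auto
  have h_upd: "?h (c(0 := z)) = ?h c" for c z
    by (intro sum.cong) auto
  have "bij_betw (\<lambda>c. c(0 := y - ?h c)) ({1..n} \<rightarrow>\<^sub>E UNIV) {a \<in> coeff_vecs n. p \<in> poly_graph n a}"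
  \<comment> \<open>The inverse resets coefficient 0 to \<open>undefined\<close>, the value at 0 of
    every extensional function on \<open>{1..n}\<close>.\<close>
  proof (rule bij_betw_byWitness[where f' = "\<lambda>a. a(0 := undefined)"])
    show "\<forall>c\<in>{1..n} \<rightarrow>\<^sub>E UNIV. (c(0 := y - ?h c))(0 := undefined) = c"
      by (auto simp: fun_eq_iff PiE_def extensional_def)
    show "\<forall>a\<in>{a \<in> coeff_vecs n. p \<in> poly_graph n a}.
        (a(0 := undefined))(0 := y - ?h (a(0 := undefined))) = a"
      unfolding h_upd by (auto simp: fun_eq_iff p poly_graph_def split)
    show "(\<lambda>c. c(0 := y - ?h c)) ` ({1..n} \<rightarrow>\<^sub>E UNIV) \<subseteq> {a \<in> coeff_vecs n. p \<in> poly_graph n a}"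
      by (auto simp: p poly_graph_def split h_upd[unfolded One_nat_def] coeff_vecs_def PiE_def extensional_def)
    show "(\<lambda>a. a(0 := undefined)) ` {a \<in> coeff_vecs n. p \<in> poly_graph n a} \<subseteq> {1..n} \<rightarrow>\<^sub>E UNIV"
      by (auto simp: coeff_vecs_def PiE_def extensional_def)
  qed
  then have "card {a \<in> coeff_vecs n. p \<in> poly_graph n a} = card ({1..n} \<rightarrow>\<^sub>E (UNIV :: 'a set))"
    by (simp add: bij_betw_same_card)
  then show ?thesis by (simp add: card_PiE)
qed

text \<open>Distinct points on one vertical line never share a graph. Otherwise, once the
  coefficients of degree at least 2 are fixed, those of degree 0 and 1 solve a linear system of
  determinant \<open>x' - x\<close>, which is nonzero.\<close>

lemma card_coeff_vecs_through_two_points: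
  fixes p p' :: "'a::{field,finite} \<times> 'a"
  assumes "n \<ge> 1" "p \<noteq> p'"
  shows "card {a \<in> coeff_vecs n. p \<in> poly_graph n a \<and> p' \<in> poly_graph n a} \<le> CARD('a) ^ (n - 1)"
proof -
  obtain x y where p: "p = (x, y)" by (cases p)
  obtain x' y' where p': "p' = (x', y')" by (cases p')
  let ?S = "{a \<in> coeff_vecs n. p \<in> poly_graph n a \<and> p' \<in> poly_graph n a}"
  show ?thesis
  proof (cases "x = x'")
    case True
    then have "?S = {}" using assms(2) by (auto simp: p p' poly_graph_def)
    then show ?thesis by (simp only: card.empty le0)
  next
    case False
    have atMost: "{..n} = insert 0 (insert 1 {2..n})" using assms(1) by auto
    have split: "(\<Sum>i\<le>n. c i * z ^ i) = c 0 + c 1 * z + (\<Sum>i\<in>{2..n}. c i * z ^ i)"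
      for c :: "nat \<Rightarrow> 'a" and z
      unfolding atMost by (subst sum.insert, simp, simp)+ simp
    have "inj_on (\<lambda>a. restrict a {2..n}) ?S"
    proof (rule inj_onI)
      fix a b assume a: "a \<in> ?S" and b: "b \<in> ?S" and eq: "restrict a {2..n} = restrict b {2..n}"
      have high: "a i = b i" if "i \<in> {2..n}" for i
        using fun_cong[OF eq, of i] that by simp
      have sums: "(\<Sum>i\<in>{2..n}. a i * z ^ i) = (\<Sum>i\<in>{2..n}. b i * z ^ i)" for z
        by (intro sum.cong) (auto simp: high)
      have ex: "a 0 + a 1 * x = b 0 + b 1 * x"
        using a b sums[of x] by (auto simp: p poly_graph_def split)
      have ex': "a 0 + a 1 * x' = b 0 + b 1 * x'"
        using a b sums[of x'] by (auto simp: p' poly_graph_def split)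
      \<comment> \<open>Subtracting the two incidence equations eliminates the constant
        coefficients.\<close>
      have "(a 1 - b 1) * (x - x') = (a 0 + a 1 * x) - (a 0 + a 1 * x')
          - ((b 0 + b 1 * x) - (b 0 + b 1 * x'))"
        by (simp add: algebra_simps)
      also have "\<dots> = 0" by (simp only: ex ex') simp
      finally have one: "a 1 = b 1" using False by simp
      then have zero: "a 0 = b 0" using ex by simp
      show "a = b"
      proof (rule PiE_ext)
        show "a \<in> {..n} \<rightarrow>\<^sub>E UNIV" "b \<in> {..n} \<rightarrow>\<^sub>E UNIV"
          using a b by (auto simp: coeff_vecs_def)
        show "a i = b i" if "i \<in> {..n}" for i
          using that one zero high unfolding atMost by auto
      qed
    qed
    moreover have "(\<lambda>a. restrict a {2..n}) ` ?S \<subseteq> {2..n} \<rightarrow>\<^sub>E (UNIV :: 'a set)"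
      by auto
    ultimately have "card ?S \<le> card ({2..n} \<rightarrow>\<^sub>E (UNIV :: 'a set))"
      by (intro card_inj_on_le) (auto simp: finite_PiE)
    also have "\<dots> = CARD('a) ^ (n - 1)"
      using assms(1) by (simp add: card_PiE Suc_diff_Suc numeral_2_eq_2)
    finally show ?thesis .
  qed
qed

text \<open>First moment, by double counting incidences between points and coefficient
  vectors.\<close>

lemma sum_card_Int_poly_graph:
  fixes P :: "('a::{field,finite} \<times> 'a) set"
  shows "(\<Sum>a\<in>coeff_vecs n. card (P \<inter> poly_graph n a)) = card P * CARD('a) ^ n"
proof -
  have "(\<Sum>a\<in>coeff_vecs n. card (P \<inter> poly_graph n a))
      = (\<Sum>a\<in>coeff_vecs n. \<Sum>p\<in>P. of_bool (p \<in> poly_graph n a))"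
    by (intro sum.cong) (auto simp: Int_def)
  also have "\<dots> = (\<Sum>p\<in>P. \<Sum>a\<in>coeff_vecs n. of_bool (p \<in> poly_graph n a))"
    by (rule sum.swap)
  also have "\<dots> = (\<Sum>p\<in>P. card {a \<in> coeff_vecs n. p \<in> poly_graph n a})"
    by (intro sum.cong) (auto simp: Int_def)
  finally show ?thesis by (simp add: card_coeff_vecs_through_point)
qed

text \<open>Second moment: the square counts ordered pairs of points of \<open>P\<close> on the
  graph, and the diagonal pairs are bounded apart from the others.\<close>

lemma sum_card_Int_poly_graph_squared_le:
  fixes P :: "('a::{field,finite} \<times> 'a) set"
  assumes "n \<ge> 1"
  shows "(\<Sum>a\<in>coeff_vecs n. (card (P \<inter> poly_graph n a))\<^sup>2)
    \<le> card P * CARD('a) ^ n + (card P)\<^sup>2 * CARD('a) ^ (n - 1)"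
proof -
  let ?on = "\<lambda>p a. of_bool (p \<in> poly_graph n a) :: nat"
  let ?N = "\<lambda>p p'. card {a \<in> coeff_vecs n. p \<in> poly_graph n a \<and> p' \<in> poly_graph n a}"
  have "(\<Sum>a\<in>coeff_vecs n. (card (P \<inter> poly_graph n a))\<^sup>2)
      = (\<Sum>a\<in>coeff_vecs n. (\<Sum>p\<in>P. ?on p a) * (\<Sum>p'\<in>P. ?on p' a))"
    by (intro sum.cong) (auto simp: Int_def power2_eq_square)
  also have "\<dots> = (\<Sum>a\<in>coeff_vecs n. \<Sum>p\<in>P. \<Sum>p'\<in>P. ?on p a * ?on p' a)"
    by (simp only: sum_product)
  also have "\<dots> = (\<Sum>p\<in>P. \<Sum>a\<in>coeff_vecs n. \<Sum>p'\<in>P. ?on p a * ?on p' a)"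
    by (rule sum.swap)
  also have "\<dots> = (\<Sum>p\<in>P. \<Sum>p'\<in>P. \<Sum>a\<in>coeff_vecs n. ?on p a * ?on p' a)"
    by (intro sum.cong refl sum.swap)
  also have "\<dots> = (\<Sum>p\<in>P. \<Sum>p'\<in>P. ?N p p')"
    by (intro sum.cong refl) (simp add: of_bool_conj[symmetric] Int_def del: of_bool_conj)
  \<comment> \<open>Diagonal pairs receive both terms; this slight excess replaces the count of
    off-diagonal pairs by \<open>(card P)\<^sup>2\<close>.\<close>
  also have "\<dots> \<le> (\<Sum>p\<in>P. \<Sum>p'\<in>P. (if p' = p then CARD('a) ^ n else 0) + CARD('a) ^ (n - 1))"
  proof (intro sum_mono)
    fix p p' assume "p \<in> P" "p' \<in> P"
    show "?N p p' \<le> (if p' = p then CARD('a) ^ n else 0) + CARD('a) ^ (n - 1)"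
      using card_coeff_vecs_through_two_points[OF assms, of p p']
      by (cases "p' = p") (simp_all add: card_coeff_vecs_through_point)
  qed
  also have "\<dots> = card P * CARD('a) ^ n + (card P)\<^sup>2 * CARD('a) ^ (n - 1)"
    by (simp add: sum.distrib power2_eq_square algebra_simps)
  finally show ?thesis .
qed

text \<open>The pair term of the second moment is exactly what centring at the mean removes, so only
  the diagonal contribution survives.\<close>

lemma sum_deviation_squared_le:
  fixes P :: "('a::{field,finite} \<times> 'a) set"
  assumes "n \<ge> 1"
  shows "(\<Sum>a\<in>coeff_vecs n. (real (card (P \<inter> poly_graph n a)) - card P / CARD('a))\<^sup>2)
    \<le> card P * real CARD('a) ^ n"
proof -
  let ?A = "coeff_vecs n :: (nat \<Rightarrow> 'a) set"
  let ?k = "\<lambda>a. card (P \<inter> poly_graph n a)"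
  define q where "q = real CARD('a)"
  define m where "m = real (card P)"
  have q: "q > 0" by (simp add: q_def)
  obtain l where l: "n = Suc l" using assms by (cases n) auto
  have first: "(\<Sum>a\<in>?A. real (?k a)) = m * q ^ n"
    using arg_cong[OF sum_card_Int_poly_graph[of P n], of real] by (simp add: q_def m_def)
  have "real (\<Sum>a\<in>?A. (?k a)\<^sup>2) \<le> real (card P * CARD('a) ^ n + (card P)\<^sup>2 * CARD('a) ^ (n - 1))"
    using sum_card_Int_poly_graph_squared_le[OF assms, of P] by (simp only: of_nat_le_iff)
  then have second: "(\<Sum>a\<in>?A. (real (?k a))\<^sup>2) \<le> m * q ^ n + m\<^sup>2 * q ^ l"
    by (simp add: q_def m_def l)
  have "(\<Sum>a\<in>?A. (real (?k a) - m / q)\<^sup>2)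
      = (\<Sum>a\<in>?A. (real (?k a))\<^sup>2 - 2 * (m / q) * real (?k a) + (m / q)\<^sup>2)"
    by (intro sum.cong) (auto simp: power2_diff)
  also have "\<dots> = (\<Sum>a\<in>?A. (real (?k a))\<^sup>2) - 2 * (m / q) * (m * q ^ n) + q ^ Suc n * (m / q)\<^sup>2"
    unfolding sum.distrib sum_subtractf sum_distrib_left[symmetric] first
    by (simp add: card_coeff_vecs q_def)
  \<comment> \<open>The cross term is \<open>-2 * m\<^sup>2 * q ^ l\<close> and the constant term
    adds back \<open>m\<^sup>2 * q ^ l\<close>.\<close>
  also have "\<dots> = (\<Sum>a\<in>?A. (real (?k a))\<^sup>2) - m\<^sup>2 * q ^ l"
    using q by (simp add: l field_simps power2_eq_square)
  also have "\<dots> \<le> m * q ^ n" using second by simp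
  finally show ?thesis by (simp add: q_def m_def)
qed

lemma card_incidences:
  assumes "finite P" "finite Q"
  shows "card {(p, C). p \<in> P \<and> C \<in> Q \<and> p \<in> C} = (\<Sum>C\<in>Q. card (P \<inter> C))"
proof -
  have "{(p, C). p \<in> P \<and> C \<in> Q \<and> p \<in> C} = prod.swap ` (SIGMA C:Q. P \<inter> C)"
    by auto
  then show ?thesis using assms by (simp add: card_image)
qed

theorem theorem2p1:
  fixes n q :: nat
    and P :: "('a::{field,finite} \<times> 'a) set"
    and Q :: "('a \<times> 'a) set set"
  assumes "n \<ge> 1"
    and "primepow q"
    and "CARD('a) = q"
    and "q > n"
    and "\<forall>C\<in>Q. \<exists>a :: nat \<Rightarrow> 'a. C = {(x, y). y = (\<Sum>i\<le>n. a i * x ^ i)}"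
  shows "\<bar>real (card {(p, C). p \<in> P \<and> C \<in> Q \<and> p \<in> C}) - real (card P) * real (card Q) / real q\<bar>
           \<le> real q powr (real n / 2) * sqrt (real (card P) * real (card Q))"
proof -
  let ?d = "\<lambda>C. real (card (P \<inter> C)) - card P / q"
  have "Q \<subseteq> poly_graph n ` coeff_vecs n"
  proof
    fix C assume "C \<in> Q"
    then obtain a :: "nat \<Rightarrow> 'a" where "C = poly_graph n a"
      using assms(5) by (auto simp: poly_graph_def)
    then have "C = poly_graph n (restrict a {..n})" by (simp add: poly_graph_restrict)
    then show "C \<in> poly_graph n ` coeff_vecs n" by (auto simp: coeff_vecs_def)
  qed
  \<comment> \<open>\<open>B\<close> holds one coefficient vector for each curve in
    \<open>Q\<close>, so sums over \<open>Q\<close> become sums over \<open>B\<close> without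
    repetition.\<close>
  then obtain B where B: "B \<subseteq> coeff_vecs n" "inj_on (poly_graph n) B" "Q = poly_graph n ` B"
    by (auto simp: subset_image_inj)
  have "(\<Sum>C\<in>Q. (?d C)\<^sup>2) = (\<Sum>a\<in>B. (?d (poly_graph n a))\<^sup>2)"
    by (simp add: B(3) sum.reindex[OF B(2)])
  \<comment> \<open>The added terms are squares, so extending the sum to all coefficient vectors can
    only increase it.\<close>
  also have "\<dots> \<le> (\<Sum>a\<in>coeff_vecs n. (?d (poly_graph n a))\<^sup>2)"
    using B(1) by (intro sum_mono2) auto
  also have "\<dots> \<le> card P * real q ^ n"
    using sum_deviation_squared_le[OF assms(1), of P] by (simp add: assms(3))
  finally have var: "(\<Sum>C\<in>Q. (?d C)\<^sup>2) \<le> card P * real q ^ n" .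
  have "real (card {(p, C). p \<in> P \<and> C \<in> Q \<and> p \<in> C}) - card P * card Q / q = (\<Sum>C\<in>Q. ?d C)"
    by (simp add: card_incidences sum_subtractf)
  moreover have "(\<Sum>C\<in>Q. ?d C)\<^sup>2 \<le> real (card P * card Q) * real q ^ n"
  proof -
    \<comment> \<open>Cauchy-Schwarz against the constant function 1, whose squares sum to
      \<open>card Q\<close>.\<close>
    have "(\<Sum>C\<in>Q. ?d C)\<^sup>2 \<le> card Q * (\<Sum>C\<in>Q. (?d C)\<^sup>2)"
      using Cauchy_Schwarz_ineq_sum[of "\<lambda>_. 1" ?d Q] by simp
    also have "\<dots> \<le> card Q * (card P * real q ^ n)"
      using var by (intro mult_left_mono) auto
    finally show ?thesis by (simp add: mult_ac)
  qed
  then have "\<bar>\<Sum>C\<in>Q. ?d C\<bar> \<le> sqrt (real (card P * card Q) * real q ^ n)"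
    using real_le_rsqrt by (simp flip: real_sqrt_abs)
  \<comment> \<open>Passing from \<open>^\<close> to \<open>powr\<close> requires a positive base,
    which \<open>q > n\<close> provides.\<close>
  moreover have "sqrt (real q ^ n) = real q powr (real n / 2)"
    using assms(4) by (simp add: powr_half_sqrt[symmetric] powr_realpow[symmetric] powr_powr)
  ultimately show ?thesis by (simp add: real_sqrt_mult mult_ac)
qed

end
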